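(* Let $G=(\Gamma,R,B)$ be a $2$-edge-coloured graph on $n$ vertices with $\chi(G)=n$. Then \[P(G\cup K_2^r,\lambda)=\lambda(\lambda-1)\cdots(\lambda-n+1)\left(\lambda^2-\lambda-2|B|\right).\]
   Context: All graphs are finite and simple. A $2$-edge-coloured graph is a triple $G=(\Gamma,R,B)$ with $R,B\subseteq E(\Gamma)$, $R\cap B=\emptyset$, $R\cup B=E(\Gamma)$ (red and blue edges). A $k$-colouring of $G$ is a proper vertex colouring $c:V(\Gamma)\to\{1,\dots,k\}$ of $\Gamma$ such that for every $ux\in R$ and $vy\in B$ (either endpoint may play the role of $u$, resp. $v$), $c(u)=c(v)$ implies $c(x)\ne c(y)$. $\chi(G)$ is the least $k$ for which $G$ has a $k$-colouring, and $P(G,\lambda)$ is the polynomial whose value at each non-negative integer $k$ is the number of $k$-colourings of $G$. $K_2^r$ is the $2$-edge-coloured graph consisting of a single red edge, and $G\cup H$ denotes the disjoint union of $2$-edge-coloured graphs (edges keep their colours). *)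

theory Defs
  imports Complex_Main "HOL-Library.FuncSet" "HOL-Computational_Algebra.Polynomial"
begin

record 'a ugraph =
  verts :: "'a set"
  edges :: "'a set set"

definition finite_simple_graph :: "'a ugraph \<Rightarrow> bool" where
  "finite_simple_graph \<Gamma> \<longleftrightarrow>
     finite (verts \<Gamma>) \<and> (\<forall>e\<in>edges \<Gamma>. e \<subseteq> verts \<Gamma> \<and> card e = 2)"

record 'a ec_graph =
  under :: "'a ugraph"
  reds :: "'a set set"
  blues :: "'a set set"

definition two_edge_coloured_graph :: "'a ec_graph \<Rightarrow> bool" where
  "two_edge_coloured_graph G \<longleftrightarrow>
     finite_simple_graph (under G) \<and>
     reds G \<subseteq> edges (under G) \<and> blues G \<subseteq> edges (under G) \<and>
     reds G \<inter> blues G = {} \<and> reds G \<union> blues G = edges (under G)"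

(* Edges are unordered pairs, so {u, x} and {v, y} below range over both orientations
   of every edge.  Colourings are extensional functions (undefined outside the
   vertex set), so that counting them counts maps from the vertex set to {1..k}. *)

definition proper_colouring :: "'a ugraph \<Rightarrow> ('a \<Rightarrow> nat) \<Rightarrow> bool" where
  "proper_colouring \<Gamma> c \<longleftrightarrow> (\<forall>u v. {u, v} \<in> edges \<Gamma> \<longrightarrow> c u \<noteq> c v)"

definition colouring :: "'a ec_graph \<Rightarrow> nat \<Rightarrow> ('a \<Rightarrow> nat) \<Rightarrow> bool" where
  "colouring G k c \<longleftrightarrow>
     c \<in> verts (under G) \<rightarrow>\<^sub>E {1..k} \<and>
     proper_colouring (under G) c \<and>
     (\<forall>u x v y. {u, x} \<in> reds G \<longrightarrow> {v, y} \<in> blues G \<longrightarrow> c u = c v \<longrightarrow> c x \<noteq> c y)"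

definition chromatic_number :: "'a ec_graph \<Rightarrow> nat" where
  "chromatic_number G = (LEAST k. \<exists>c. colouring G k c)"

definition chromatic_poly :: "'a ec_graph \<Rightarrow> real poly" where
  "chromatic_poly G =
     (THE p. \<forall>k::nat. poly p (real k) = real (card {c. colouring G k c}))"

definition red_K2 :: "bool ec_graph" where
  "red_K2 = \<lparr>under = \<lparr>verts = {False, True}, edges = {{False, True}}\<rparr>,
             reds = {{False, True}}, blues = {}\<rparr>"

definition disjoint_union :: "'a ec_graph \<Rightarrow> 'b ec_graph \<Rightarrow> ('a + 'b) ec_graph" where
  "disjoint_union G H =
     \<lparr>under = \<lparr>verts = Inl ` verts (under G) \<union> Inr ` verts (under H),
               edges = (`) Inl ` edges (under G) \<union> (`) Inr ` edges (under H)\<rparr>,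
      reds = (`) Inl ` reds G \<union> (`) Inr ` reds H,
      blues = (`) Inl ` blues G \<union> (`) Inr ` blues H\<rparr>"

lemma two_edge_coloured_graph_red_K2: "two_edge_coloured_graph red_K2"
  by (auto simp: two_edge_coloured_graph_def finite_simple_graph_def red_K2_def)

lemma two_edge_coloured_graph_disjoint_union:
  assumes "two_edge_coloured_graph G" "two_edge_coloured_graph H"
  shows "two_edge_coloured_graph (disjoint_union G H)"
proof -
  have emp: "{} \<notin> edges (under G)"
    using assms(1) by (auto simp: two_edge_coloured_graph_def finite_simple_graph_def)
  have ne: "Inl ` e \<noteq> Inr ` f" if "e \<noteq> {}" for e :: "'a set" and f :: "'b set"
    using that by auto
  have RG: "reds G \<union> blues G = edges (under G)" "reds G \<inter> blues G = {}"
    and RH: "reds H \<union> blues H = edges (under H)" "reds H \<inter> blues H = {}"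
    using assms by (auto simp: two_edge_coloured_graph_def)
  have "(`) Inl ` reds G \<inter> (`) Inl ` blues G = {}"
    and "(`) Inr ` reds H \<inter> (`) Inr ` blues H = {}"
    using RG(2) RH(2) by (auto simp: inj_image_eq_iff)
  moreover have "(`) Inl ` reds G \<inter> (`) Inr ` blues H = {}"
    and "(`) Inr ` reds H \<inter> (`) Inl ` blues G = {}"
  proof -
    have "e \<noteq> {}" if "e \<in> reds G \<union> blues G" for e
      using that emp RG(1) by auto
    then show "(`) Inl ` reds G \<inter> (`) Inr ` blues H = {}"
      and "(`) Inr ` reds H \<inter> (`) Inl ` blues G = {}"
      by (auto dest: ne[of _ _] ne[symmetric])
  qed
  ultimately have disj: "reds (disjoint_union G H) \<inter> blues (disjoint_union G H) = {}"
    unfolding disjoint_union_def by (simp add: Int_Un_distrib Int_Un_distrib2)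
  have fin: "finite_simple_graph (under (disjoint_union G H))"
    using assms unfolding two_edge_coloured_graph_def finite_simple_graph_def disjoint_union_def
    by (fastforce simp: card_image)
  have uni: "reds (disjoint_union G H) \<union> blues (disjoint_union G H)
               = edges (under (disjoint_union G H))"
    unfolding disjoint_union_def by (auto simp flip: RG(1) RH(1))
  show ?thesis
    unfolding two_edge_coloured_graph_def using disj fin uni by simp blast
qed

lemma poly_eq_if_eq_on_nat:
  fixes p q :: "real poly"
  assumes "\<And>k::nat. poly p (real k) = poly q (real k)"
  shows "p = q"
proof -
  have "range real \<subseteq> {x. poly (p - q) x = 0}"
    using assms by auto
  moreover have "infinite (range real)"
    by (simp add: finite_image_iff)
  ultimately have "p - q = 0"
    using poly_roots_finite finite_subset by blast
  then show ?thesis by simp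
qed

lemma binomial_is_poly: "\<exists>p::real poly. \<forall>k::nat. poly p (real k) = real (k choose s)"
proof (intro exI allI)
  fix k :: nat
  show "poly (smult (1 / fact s) (\<Prod>i = 0..<s. [:- real i, 1:])) (real k) = real (k choose s)"
    by (simp add: binomial_gbinomial gbinomial_prod_rev poly_prod)
qed

lemma colouring_comp:
  assumes G: "two_edge_coloured_graph G" and c: "colouring G k c" and inj: "inj_on f (c ` verts (under G))"
    and f: "f ` c ` verts (under G) \<subseteq> {1..l}"
  shows "colouring G l (restrict (f \<circ> c) (verts (under G)))"
proof -
  let ?V = "verts (under G)"
  have E: "u \<in> ?V \<and> v \<in> ?V" if "{u, v} \<in> edges (under G)" for u v
  proof -
    have "{u, v} \<subseteq> ?V"
      using G that by (simp only: two_edge_coloured_graph_def finite_simple_graph_def)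
    then show ?thesis by simp
  qed
  have R: "reds G \<subseteq> edges (under G)" "blues G \<subseteq> edges (under G)"
    using G unfolding two_edge_coloured_graph_def by auto
  have eq: "f (c u) = f (c v) \<longleftrightarrow> c u = c v" if "u \<in> ?V" "v \<in> ?V" for u v
    using inj_on_eq_iff[OF inj, of "c u" "c v"] that by simp
  show ?thesis
    unfolding colouring_def proper_colouring_def
  proof (intro conjI allI impI)
    show "restrict (f \<circ> c) ?V \<in> ?V \<rightarrow>\<^sub>E {1..l}"
      using f by auto
  next
    fix u v assume "{u, v} \<in> edges (under G)"
    then show "restrict (f \<circ> c) ?V u \<noteq> restrict (f \<circ> c) ?V v"
      using E[of u v] c eq by (auto simp: colouring_def proper_colouring_def)
  next
    fix u x v y assume a: "{u, x} \<in> reds G" "{v, y} \<in> blues G"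
      "restrict (f \<circ> c) ?V u = restrict (f \<circ> c) ?V v"
    have V: "u \<in> ?V" "x \<in> ?V" "v \<in> ?V" "y \<in> ?V"
      using E[of u x] E[of v y] a R by auto
    then have "c u = c v" using a(3) eq by simp
    then have "c x \<noteq> c y" using c a(1,2) unfolding colouring_def by blast
    then show "restrict (f \<circ> c) ?V x \<noteq> restrict (f \<circ> c) ?V y"
      using V eq by simp
  qed
qed

lemma card_colourings_image:
  assumes G: "two_edge_coloured_graph G" and S: "S \<subseteq> {1..k}"
  shows "card {c. colouring G k c \<and> c ` verts (under G) = S}
       = card {c. colouring G (card S) c \<and> c ` verts (under G) = {1..card S}}"
proof -
  let ?V = "verts (under G)"
  have "finite S" using S finite_subset by blast
  then obtain f where f: "bij_betw f S {1..card S}"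
    using finite_same_card_bij[of S "{1..card S}"] by auto
  define g where "g = inv_into S f"
  have g: "bij_betw g {1..card S} S"
    unfolding g_def using f by (rule bij_betw_inv_into)
  have gf: "g (f x) = x" if "x \<in> S" for x
    unfolding g_def using f that by (simp add: bij_betw_inv_into_left)
  have fg: "f (g x) = x" if "x \<in> {1..card S}" for x
    unfolding g_def using f that by (simp add: bij_betw_inv_into_right)
  let ?A = "{c. colouring G k c \<and> c ` ?V = S}"
  let ?B = "{c. colouring G (card S) c \<and> c ` ?V = {1..card S}}"
  let ?F = "\<lambda>c. restrict (f \<circ> c) ?V" and ?H = "\<lambda>c. restrict (g \<circ> c) ?V"
  have "bij_betw ?F ?A ?B"
  proof (rule bij_betw_byWitness[where f' = ?H])
    show "\<forall>c\<in>?A. ?H (?F c) = c"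
    proof
      fix c assume c: "c \<in> ?A"
      have "c \<in> extensional ?V" using c by (auto simp: colouring_def PiE_def)
      then show "?H (?F c) = c"
        using c gf by (auto simp: fun_eq_iff extensional_def)
    qed
    show "\<forall>c\<in>?B. ?F (?H c) = c"
    proof
      fix c assume c: "c \<in> ?B"
      have "c \<in> extensional ?V" using c by (auto simp: colouring_def PiE_def)
      moreover have "f (g (c v)) = c v" if "v \<in> ?V" for v
        using c that by (intro fg) blast
      ultimately show "?F (?H c) = c"
        by (auto simp: fun_eq_iff extensional_def)
    qed
    show "?F ` ?A \<subseteq> ?B"
    proof
      fix d assume "d \<in> ?F ` ?A"
      then obtain c where c: "colouring G k c" "c ` ?V = S" and d: "d = ?F c" by blast
      have "d ` ?V = f ` c ` ?V" unfolding d by (auto simp: image_iff)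
      then have "d ` ?V = {1..card S}" using c f by (simp add: bij_betw_def)
      moreover have "colouring G (card S) d"
        unfolding d using colouring_comp[OF G c(1), of f] c(2) f by (simp add: bij_betw_def)
      ultimately show "d \<in> ?B" by simp
    qed
    show "?H ` ?B \<subseteq> ?A"
    proof
      fix d assume "d \<in> ?H ` ?B"
      then obtain c where c: "colouring G (card S) c" "c ` ?V = {1..card S}" and d: "d = ?H c"
        by blast
      have "d ` ?V = g ` c ` ?V" unfolding d by (auto simp: image_iff)
      then have "d ` ?V = S" using c g by (simp add: bij_betw_def)
      moreover have "colouring G k d"
        unfolding d using colouring_comp[OF G c(1), of g] c(2) g S by (simp add: bij_betw_def)
      ultimately show "d \<in> ?A" by simp
    qed
  qed
  then show ?thesis by (rule bij_betw_same_card)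
qed

(* The description in the definition of chromatic_poly is satisfied by exactly one polynomial. *)

lemma chromatic_poly_ex1:
  assumes G: "two_edge_coloured_graph G"
  shows "\<exists>!p::real poly. \<forall>k::nat. poly p (real k) = real (card {c. colouring G k c})"
proof -
  let ?V = "verts (under G)"
  have finV: "finite ?V"
    using G by (simp add: two_edge_coloured_graph_def finite_simple_graph_def)
  define n where "n = card ?V"
  define a where "a s = card {c. colouring G s c \<and> c ` ?V = {1..s}}" for s
  obtain b :: "nat \<Rightarrow> real poly" where b: "\<And>s k. poly (b s) (real k) = real (k choose s)"
    using binomial_is_poly by metis
  define p where "p = (\<Sum>s\<le>n. smult (real (a s)) (b s))"
  have "poly p (real k) = real (card {c. colouring G k c})" for k
  proof -
    let ?C = "{c. colouring G k c}"
    have finC: "finite ?C"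
      by (rule finite_subset[of _ "?V \<rightarrow>\<^sub>E {1..k}"])
        (auto simp: colouring_def intro!: finite_PiE finV)
    have a0: "a s = 0" if "s > n" for s
    proof -
      have "card (c ` ?V) \<le> n" for c :: "'a \<Rightarrow> nat"
        unfolding n_def by (rule card_image_le[OF finV])
      then have "c ` ?V \<noteq> {1..s}" for c :: "'a \<Rightarrow> nat"
        using that by (metis card_atLeastAtMost diff_Suc_1 leD)
      then show ?thesis by (simp add: a_def)
    qed
    have "card ?C = (\<Sum>S\<in>Pow {1..k}. card {c \<in> ?C. c ` ?V = S})"
    proof -
      have "?C = (\<Union>S\<in>Pow {1..k}. {c \<in> ?C. c ` ?V = S})"
        by (auto simp: colouring_def)
      moreover have "card (\<Union>S\<in>Pow {1..k}. {c \<in> ?C. c ` ?V = S})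
          = (\<Sum>S\<in>Pow {1..k}. card {c \<in> ?C. c ` ?V = S})"
        by (rule card_UN_disjoint) (use finC in auto)
      ultimately show ?thesis by (rule trans[OF arg_cong[where f = card]])
    qed
    also have "\<dots> = (\<Sum>S\<in>Pow {1..k}. a (card S))"
    proof (rule sum.cong[OF refl])
      fix S assume "S \<in> Pow {1..k}"
      then show "card {c \<in> ?C. c ` ?V = S} = a (card S)"
        unfolding a_def using card_colourings_image[OF G, of S k] by simp
    qed
    also have "\<dots> = (\<Sum>s\<le>k. \<Sum>S\<in>{S \<in> Pow {1..k}. card S = s}. a (card S))"
      by (rule sum.group[symmetric])
        (use card_mono[of "{1..k}"] in auto)
    also have "\<dots> = (\<Sum>s\<le>k. (k choose s) * a s)"
    proof (rule sum.cong[OF refl])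
      fix s
      have "(\<Sum>S\<in>{S \<in> Pow {1..k}. card S = s}. a (card S))
          = card {S. S \<subseteq> {1..k} \<and> card S = s} * a s"
        by simp
      also have "card {S. S \<subseteq> {1..k} \<and> card S = s} = k choose s"
        using n_subsets[of "{1..k}" s] by simp
      finally show "(\<Sum>S\<in>{S \<in> Pow {1..k}. card S = s}. a (card S)) = (k choose s) * a s" .
    qed
    also have "\<dots> = (\<Sum>s\<le>max k n. (k choose s) * a s)"
      by (rule sum.mono_neutral_left) auto
    also have "\<dots> = (\<Sum>s\<le>n. (k choose s) * a s)"
      by (rule sum.mono_neutral_right) (auto simp: a0)
    finally show ?thesis
      by (simp add: p_def poly_sum b mult.commute)
  qed
  then show ?thesis
    by (intro ex1I[of _ p]) (auto intro!: poly_eq_if_eq_on_nat)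
qed

lemma poly_chromatic_poly:
  assumes "two_edge_coloured_graph G"
  shows "poly (chromatic_poly G) (real k) = real (card {c. colouring G k c})"
  using theI'[OF chromatic_poly_ex1[OF assms]] by (simp add: chromatic_poly_def)

end

theory Submission
  imports Defs
begin

text \<open>If the chromatic number equals the number \<open>n\<close> of vertices, then the \<open>k\<close>-colourings of \<open>G\<close>
  are exactly the injective maps into \<open>{1..k}\<close>: a non-injective colouring could be relabelled with
  fewer than \<open>n\<close> colours. Given such a \<open>c\<close>, the end vertices of the additional red edge may receive
  any two distinct colours \<open>a\<close>, \<open>b\<close> except those with \<open>(a, b) = (c v, c y)\<close> for a blue edge
  \<open>{v, y}\<close>; by injectivity exactly \<open>2|B|\<close> ordered pairs are excluded.\<close>

section \<open>Edges as ordered pairs and as images\<close>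

text \<open>Both orientations of each edge are recorded, because the two ends of the added red edge
  receive an ordered pair of colours. This is the origin of the factor 2 in 2|B|.\<close>

definition arcs :: "'a set set \<Rightarrow> ('a \<times> 'a) set" where
  "arcs E = {(u, v). {u, v} \<in> E}"

lemma card_arcs:
  assumes "finite E" and two: "\<And>e. e \<in> E \<Longrightarrow> card e = 2"
  shows "card (arcs E) = 2 * card E"
proof -
  have one: "finite (arcs {e})" "card (arcs {e}) = 2" if e: "e \<in> E" for e
  proof -
    obtain u v where uv: "e = {u, v}" "u \<noteq> v"
      using two[OF e] by (meson card_2_iff)
    then have "arcs {e} = {(u, v), (v, u)}"
      by (auto simp: arcs_def doubleton_eq_iff)
    then show "finite (arcs {e})" "card (arcs {e}) = 2"
      using uv(2) by auto
  qed
  have "arcs E = (\<Union>e\<in>E. arcs {e})"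
    by (auto simp: arcs_def)
  also have "card \<dots> = (\<Sum>e\<in>E. card (arcs {e}))"
    by (rule card_UN_disjoint) (use assms one in \<open>auto simp: arcs_def\<close>)
  also have "\<dots> = 2 * card E"
    using one by simp
  finally show ?thesis .
qed

text \<open>Applied with \<open>Inl\<close> and \<open>Inr\<close> to trace an edge of a disjoint
  union back to its summand; it holds because taking images of sets under an injection is again
  injective.\<close>

lemma doubleton_in_image_iff:
  assumes "inj f"
  shows "{u, v} \<in> (`) f ` E \<longleftrightarrow> (\<exists>u' v'. u = f u' \<and> v = f v' \<and> {u', v'} \<in> E)"
proof
  assume "{u, v} \<in> (`) f ` E"
  then obtain e where e: "e \<in> E" "f ` e = {u, v}" by auto
  then have "u \<in> f ` e" "v \<in> f ` e" by simp_all
  then obtain u' v' where u'v': "u = f u'" "v = f v'" by blast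
  have "f ` e = f ` {u', v'}" using e(2) u'v' by simp
  then have "e = {u', v'}" by (simp only: inj_image_eq_iff[OF assms])
  then show "\<exists>u' v'. u = f u' \<and> v = f v' \<and> {u', v'} \<in> E"
    using u'v' e(1) by blast
next
  assume "\<exists>u' v'. u = f u' \<and> v = f v' \<and> {u', v'} \<in> E"
  then obtain u' v' where "{u, v} = f ` {u', v'}" "{u', v'} \<in> E" by auto
  then show "{u, v} \<in> (`) f ` E" by (rule image_eqI)
qed

section \<open>Colourings of a graph with \<chi>(G) = n\<close>

lemma colouring_inj_on:
  assumes G: "two_edge_coloured_graph G"
    and n: "chromatic_number G = card (verts (under G))" and c: "colouring G k c"
  shows "inj_on c (verts (under G))"
proof -
  let ?V = "verts (under G)"
  have fin: "finite ?V"
    using G by (simp add: two_edge_coloured_graph_def finite_simple_graph_def)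
  \<comment> \<open>\<open>f\<close> renumbers the colours that occur as 1, ..., m with m = |c(V)|,
    which turns \<open>c\<close> into an m-colouring.\<close>
  obtain f where f: "bij_betw f (c ` ?V) {1..card (c ` ?V)}"
    using finite_same_card_bij[of "c ` ?V" "{1..card (c ` ?V)}"] fin by auto
  have "colouring G (card (c ` ?V)) (restrict (f \<circ> c) ?V)"
    by (rule colouring_comp[OF G c]) (use f in \<open>auto simp: bij_betw_def\<close>)
  then have "chromatic_number G \<le> card (c ` ?V)"
    unfolding chromatic_number_def by (intro Least_le) blast
  \<comment> \<open>Minimality gives n \<le> |c(V)|, and a map on n points with at least n values is
    injective.\<close>
  then show ?thesis
    using n card_image_le[OF fin, of c] by (intro eq_card_imp_inj_on[OF fin]) simp
qed

text \<open>A violation of the mixed condition would, by injectivity, come from u = v and x = y,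
  that is, from a single edge that is both red and blue.\<close>

lemma inj_on_colouring:
  assumes G: "two_edge_coloured_graph G"
    and c: "c \<in> verts (under G) \<rightarrow>\<^sub>E {1..k}" and inj: "inj_on c (verts (under G))"
  shows "colouring G k c"
proof -
  have E: "u \<in> verts (under G)" "v \<in> verts (under G)" "u \<noteq> v"
    if "{u, v} \<in> edges (under G)" for u v
  proof -
    have "{u, v} \<subseteq> verts (under G)" "card {u, v} = 2"
      using G that by (simp_all only: two_edge_coloured_graph_def finite_simple_graph_def)
    then show "u \<in> verts (under G)" "v \<in> verts (under G)" "u \<noteq> v" by auto
  qed
  have RB: "reds G \<subseteq> edges (under G)" "blues G \<subseteq> edges (under G)" "reds G \<inter> blues G = {}"
    using G by (auto simp: two_edge_coloured_graph_def)
  show ?thesis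
    unfolding colouring_def proper_colouring_def
  proof (intro conjI allI impI)
    fix u v assume "{u, v} \<in> edges (under G)"
    then show "c u \<noteq> c v" using E[of u v] inj_on_eq_iff[OF inj, of u v] by blast
  next
    fix u x v y assume ux: "{u, x} \<in> reds G" and vy: "{v, y} \<in> blues G" and "c u = c v"
    then have "u = v"
      using E[of u x] E[of v y] RB inj_on_eq_iff[OF inj, of u v] by blast
    show "c x \<noteq> c y"
    proof
      assume "c x = c y"
      then have "x = y"
        using E[of u x] E[of v y] RB ux vy inj_on_eq_iff[OF inj, of x y] by blast
      then show False using \<open>u = v\<close> ux vy RB(3) by blast
    qed
  qed (rule c)
qed

lemma colourings_eq_inj_on:
  assumes "two_edge_coloured_graph G" "chromatic_number G = card (verts (under G))"
  shows "{c. colouring G k c} = {c \<in> verts (under G) \<rightarrow>\<^sub>E {1..k}. inj_on c (verts (under G))}"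
proof (intro Collect_cong iffI conjI)
  fix c assume c: "colouring G k c"
  then show "c \<in> verts (under G) \<rightarrow>\<^sub>E {1..k}" by (simp add: colouring_def)
  show "inj_on c (verts (under G))" by (rule colouring_inj_on[OF assms c])
next
  fix c
  assume "c \<in> verts (under G) \<rightarrow>\<^sub>E {1..k} \<and> inj_on c (verts (under G))"
  then show "colouring G k c" using inj_on_colouring[OF assms(1)] by blast
qed

section \<open>Extending a colouring to the added red edge\<close>

text \<open>\<open>case_bool\<close> takes its value at \<open>True\<close> first, so
  \<open>a\<close> is the colour of \<open>Inr False\<close> and \<open>b\<close> that of
  \<open>Inr True\<close>. Removing \<open>Id\<close> expresses properness on the new edge; removing
  the image of the arcs expresses its mixed condition against the blue edges, all of which lie in
  G.\<close>

lemma colouring_disjoint_union_red_K2_iff: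
  "colouring (disjoint_union G red_K2) k (case_sum c (case_bool b a)) \<longleftrightarrow>
     colouring G k c \<and>
     (a, b) \<in> ({1..k} \<times> {1..k} - Id) - map_prod c c ` arcs (blues G)"
  (is "colouring ?U k ?d \<longleftrightarrow> _")
proof -
  \<comment> \<open>An orientation of the added edge is determined by its first end
    \<open>s\<close>; the other end is \<open>\<not> s\<close>.\<close>
  have K: "{s, t} = {False, True} \<longleftrightarrow> t = (\<not> s)" for s t
    by (cases s; cases t) (auto simp: doubleton_eq_iff)
  have red: "{u, x} \<in> reds ?U \<longleftrightarrow>
      (\<exists>u' x'. u = Inl u' \<and> x = Inl x' \<and> {u', x'} \<in> reds G) \<or>
      (\<exists>s. u = Inr s \<and> x = Inr (\<not> s))" for u x
  proof -
    have "reds ?U = (`) Inl ` reds G \<union> (`) Inr ` {{False, True}}"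
      by (simp add: disjoint_union_def red_K2_def)
    then show ?thesis
      by (simp only: Un_iff doubleton_in_image_iff[OF inj_Inl] doubleton_in_image_iff[OF inj_Inr]
          singleton_iff K) blast
  qed
  have blue: "{u, x} \<in> blues ?U \<longleftrightarrow>
      (\<exists>u' x'. u = Inl u' \<and> x = Inl x' \<and> {u', x'} \<in> blues G)" for u x
  proof -
    have "blues ?U = (`) Inl ` blues G"
      by (simp add: disjoint_union_def red_K2_def)
    then show ?thesis
      by (simp only: doubleton_in_image_iff[OF inj_Inl])
  qed
  have edge: "{u, x} \<in> edges (under ?U) \<longleftrightarrow>
      (\<exists>u' x'. u = Inl u' \<and> x = Inl x' \<and> {u', x'} \<in> edges (under G)) \<or>
      (\<exists>s. u = Inr s \<and> x = Inr (\<not> s))" for u x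
  proof -
    have "edges (under ?U) = (`) Inl ` edges (under G) \<union> (`) Inr ` {{False, True}}"
      by (simp add: disjoint_union_def red_K2_def)
    then show ?thesis
      by (simp only: Un_iff doubleton_in_image_iff[OF inj_Inl] doubleton_in_image_iff[OF inj_Inr]
          singleton_iff K) blast
  qed
  have verts: "verts (under ?U) = Inl ` verts (under G) \<union> {Inr False, Inr True}"
    by (simp add: disjoint_union_def red_K2_def)
  \<comment> \<open>Both values of \<open>bool\<close> are vertices, so extensionality of the
    combined map concerns only \<open>c\<close>.\<close>
  have "?d \<in> verts (under ?U) \<rightarrow>\<^sub>E {1..k} \<longleftrightarrow>
      c \<in> verts (under G) \<rightarrow>\<^sub>E {1..k} \<and> (a, b) \<in> {1..k} \<times> {1..k}"
    unfolding verts PiE_iff extensional_def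
    by (auto split: sum.split bool.split)
  moreover have "proper_colouring (under ?U) ?d \<longleftrightarrow> proper_colouring (under G) c \<and> a \<noteq> b"
  proof
    assume L: "proper_colouring (under ?U) ?d"
    have "c u \<noteq> c v" if "{u, v} \<in> edges (under G)" for u v
      using L[unfolded proper_colouring_def, rule_format, of "Inl u" "Inl v"] that by (simp add: edge)
    moreover have "{Inr False, Inr True} \<in> edges (under ?U)"
      unfolding edge by blast
    then have "?d (Inr False) \<noteq> ?d (Inr True)"
      using L unfolding proper_colouring_def by blast
    then have "a \<noteq> b" by simp
    ultimately show "proper_colouring (under G) c \<and> a \<noteq> b"
      by (simp add: proper_colouring_def)
  next
    assume R: "proper_colouring (under G) c \<and> a \<noteq> b"
    show "proper_colouring (under ?U) ?d"
      unfolding proper_colouring_def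
    proof (intro allI impI)
      fix u v assume "{u, v} \<in> edges (under ?U)"
      then consider u' v' where "u = Inl u'" "v = Inl v'" "{u', v'} \<in> edges (under G)"
        | s where "u = Inr s" "v = Inr (\<not> s)"
        using edge by blast
      then show "?d u \<noteq> ?d v"
      proof cases
        case 1
        then show ?thesis using R by (simp add: proper_colouring_def)
      next
        case (2 s)
        then show ?thesis using R by (cases s) auto
      qed
    qed
  qed
  moreover have "(\<forall>u x v y. {u, x} \<in> reds ?U \<longrightarrow> {v, y} \<in> blues ?U \<longrightarrow> ?d u = ?d v \<longrightarrow> ?d x \<noteq> ?d y) \<longleftrightarrow>
      (\<forall>u x v y. {u, x} \<in> reds G \<longrightarrow> {v, y} \<in> blues G \<longrightarrow> c u = c v \<longrightarrow> c x \<noteq> c y) \<and>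
      (a, b) \<notin> map_prod c c ` arcs (blues G)" (is "?L \<longleftrightarrow> ?R1 \<and> ?R2")
  proof
    assume L: ?L
    have ?R1
    proof (intro allI impI)
      fix u x v y
      assume "{u, x} \<in> reds G" "{v, y} \<in> blues G" "c u = c v"
      then show "c x \<noteq> c y"
        using L[rule_format, of "Inl u" "Inl x" "Inl v" "Inl y"] by (simp add: red blue)
    qed
    moreover have ?R2
    proof
      assume "(a, b) \<in> map_prod c c ` arcs (blues G)"
      then obtain v y where "{v, y} \<in> blues G" "a = c v" "b = c y"
        by (auto simp: arcs_def)
      then show False
        \<comment> \<open>One orientation of the red edge suffices, since \<open>arcs\<close>
          already contains both orientations of every blue edge.\<close>
        using L[rule_format, of "Inr False" "Inr True" "Inl v" "Inl y"] red blue by auto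
    qed
    ultimately show "?R1 \<and> ?R2" ..
  next
    assume R: "?R1 \<and> ?R2"
    have ab: "\<not> (a = c v \<and> b = c y)" if "{v, y} \<in> blues G" for v y
      using R that by (force simp: arcs_def)
    show ?L
    proof (intro allI impI)
      fix u x v y
      assume ux: "{u, x} \<in> reds ?U" and vy: "{v, y} \<in> blues ?U" and eq: "?d u = ?d v"
      obtain v' y' where v'y': "v = Inl v'" "y = Inl y'" "{v', y'} \<in> blues G"
        using vy blue by blast
      \<comment> \<open>For \<open>s\<close> = \<open>True\<close> the forbidden coincidence is b =
        c(v'), a = c(y'), which is the pair excluded by the reversed blue arc.\<close>
      then have y'v': "{y', v'} \<in> blues G" by (simp add: insert_commute)
      consider u' x' where "u = Inl u'" "x = Inl x'" "{u', x'} \<in> reds G"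
        | s where "u = Inr s" "x = Inr (\<not> s)"
        using ux red by blast
      then show "?d x \<noteq> ?d y"
      proof cases
        case 1
        then show ?thesis using R v'y' eq by auto
      next
        case (2 s)
        then show ?thesis using ab[OF v'y'(3)] ab[OF y'v'] v'y' eq by (cases s) auto
      qed
    qed
  qed
  ultimately show ?thesis
    unfolding colouring_def by auto
qed

section \<open>Counting the extensions\<close>

text \<open>Every colouring of G has the same number of extensions. Over \<open>int\<close> the last
  factor is the true value of the quadratic; where it is negative, no colouring of G exists and both
  sides are 0.\<close>

lemma card_colourings_disjoint_union_red_K2:
  assumes G: "two_edge_coloured_graph G"
    and n: "chromatic_number G = card (verts (under G))"
  shows "int (card {d. colouring (disjoint_union G red_K2) k d})
       = int (card {c. colouring G k c}) * ((int k)\<^sup>2 - int k - 2 * int (card (blues G)))"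
proof -
  let ?V = "verts (under G)" and ?U = "disjoint_union G red_K2"
  have finV: "finite ?V" and edge: "\<And>e. e \<in> edges (under G) \<Longrightarrow> e \<subseteq> ?V \<and> card e = 2"
    and blues: "blues G \<subseteq> edges (under G)"
    using G by (auto simp: two_edge_coloured_graph_def finite_simple_graph_def)
  have finB: "finite (blues G)"
    by (rule finite_subset[of _ "Pow ?V"]) (use blues edge finV in auto)
  have cardB: "card (arcs (blues G)) = 2 * card (blues G)"
    by (rule card_arcs[OF finB]) (use blues edge in blast)
  have arcV: "arcs (blues G) \<subseteq> ?V \<times> ?V"
    using blues edge by (fastforce simp: arcs_def)
  have finD: "finite ({1..k} \<times> {1..k} - Id)"
    by simp
  have cardD: "int (card ({1..k} \<times> {1..k} - Id)) = (int k)\<^sup>2 - int k"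
  proof -
    have "{1..k} \<times> {1..k} - Id = {1..k} \<times> {1..k} - Id_on {1..k}" by auto
    moreover have "Id_on {1..k} = (\<lambda>i. (i, i)) ` {1..k}" by auto
    then have "card (Id_on {1..k}) = k" "finite (Id_on {1..k})"
      by (simp_all add: card_image inj_on_def)
    ultimately have "card ({1..k} \<times> {1..k} - Id) = k * k - k"
      by (simp add: card_Diff_subset Id_on_subset_Times)
    then show ?thesis by (simp add: power2_eq_square)
  qed
  let ?C = "{c. colouring G k c}"
  let ?P = "\<lambda>c. ({1..k} \<times> {1..k} - Id) - map_prod c c ` arcs (blues G)"
  have finC: "finite ?C"
    by (rule finite_subset[of _ "?V \<rightarrow>\<^sub>E {1..k}"]) (auto simp: colouring_def finV intro: finite_PiE)
  have cardP: "int (card (?P c)) = (int k)\<^sup>2 - int k - 2 * int (card (blues G))"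
    if c: "colouring G k c" for c
  proof -
    have inj: "inj_on c ?V" by (rule colouring_inj_on[OF G n c])
    then have "inj_on (map_prod c c) (arcs (blues G))"
      using map_prod_inj_on[OF inj inj] arcV inj_on_subset by blast
    then have cardI: "card (map_prod c c ` arcs (blues G)) = 2 * card (blues G)"
      by (simp add: card_image cardB)
    \<comment> \<open>The excluded pairs have distinct entries because \<open>c\<close> is proper on
      blue edges, so removing them lowers the count by exactly 2|B|.\<close>
    have sub: "map_prod c c ` arcs (blues G) \<subseteq> {1..k} \<times> {1..k} - Id"
    proof
      fix p assume "p \<in> map_prod c c ` arcs (blues G)"
      then obtain u v where p: "p = (c u, c v)" and uv: "{u, v} \<in> blues G"
        by (auto simp: arcs_def)
      have "c \<in> ?V \<rightarrow> {1..k}" "c u \<noteq> c v"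
        using c uv blues by (auto simp: colouring_def proper_colouring_def)
      moreover have "u \<in> ?V" "v \<in> ?V"
        using arcV uv by (auto simp: arcs_def)
      ultimately show "p \<in> {1..k} \<times> {1..k} - Id"
        unfolding p by blast
    qed
    show ?thesis
      using cardI cardD card_mono[OF finD sub] card_Diff_subset[OF finite_subset[OF sub finD] sub]
      by linarith
  qed
  \<comment> \<open>A colouring of the union corresponds to its part on G together with the two
    colours on the new edge.\<close>
  have "bij_betw (\<lambda>(c, a, b). case_sum c (case_bool b a)) (Sigma ?C ?P) {d. colouring ?U k d}"
  proof (rule bij_betw_byWitness[where f' = "\<lambda>d. (d \<circ> Inl, d (Inr False), d (Inr True))"])
    show "\<forall>x\<in>Sigma ?C ?P. (\<lambda>d. (d \<circ> Inl, d (Inr False), d (Inr True)))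
        ((\<lambda>(c, a, b). case_sum c (case_bool b a)) x) = x"
      by (auto simp: comp_def)
    have eta: "case_sum (d \<circ> Inl) (case_bool (d (Inr True)) (d (Inr False))) = d"
      for d :: "'a + bool \<Rightarrow> nat"
      by (auto simp: fun_eq_iff split: sum.split bool.split)
    then show "\<forall>d\<in>{d. colouring ?U k d}. (\<lambda>(c, a, b). case_sum c (case_bool b a))
        (d \<circ> Inl, d (Inr False), d (Inr True)) = d"
      by simp
    show "(\<lambda>(c, a, b). case_sum c (case_bool b a)) ` Sigma ?C ?P \<subseteq> {d. colouring ?U k d}"
      using colouring_disjoint_union_red_K2_iff by fastforce
    show "(\<lambda>d. (d \<circ> Inl, d (Inr False), d (Inr True))) ` {d. colouring ?U k d} \<subseteq> Sigma ?C ?P"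
    proof
      fix z assume "z \<in> (\<lambda>d. (d \<circ> Inl, d (Inr False), d (Inr True))) ` {d. colouring ?U k d}"
      then obtain d where d: "colouring ?U k d"
        and z: "z = (d \<circ> Inl, d (Inr False), d (Inr True))" by blast
      show "z \<in> Sigma ?C ?P"
        using d colouring_disjoint_union_red_K2_iff[of G k "d \<circ> Inl" "d (Inr True)" "d (Inr False)"]
        unfolding eta z by (intro SigmaI CollectI) simp_all
    qed
  qed
  then have "card {d. colouring ?U k d} = card (Sigma ?C ?P)"
    by (rule bij_betw_same_card[symmetric])
  also have "\<dots> = (\<Sum>c\<in>?C. card (?P c))"
    by (rule card_SigmaI) (use finC finD in auto)
  finally have "int (card {d. colouring ?U k d}) = (\<Sum>c\<in>?C. int (card (?P c)))"
    by simp
  also have "\<dots> = (\<Sum>c\<in>?C. (int k)\<^sup>2 - int k - 2 * int (card (blues G)))"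
    by (rule sum.cong[OF refl]) (use cardP in blast)
  finally show ?thesis by simp
qed

section \<open>From counts to the polynomial identity\<close>

lemma real_card_inj_on_eq_prod:
  assumes "finite V"
  shows "real (card {c \<in> V \<rightarrow>\<^sub>E {1..k}. inj_on c V}) = (\<Prod>i<card V. real k - real i)"
proof -
  have "real (card {c \<in> V \<rightarrow>\<^sub>E {1..k}. inj_on c V}) = (\<Prod>i<card V. real (k - i))"
    using card_inj_on_subset_funcset[OF assms, of "{1..k}" V]
    by (simp add: atLeast0LessThan)
  also have "\<dots> = (\<Prod>i<card V. real k - real i)"
  proof (cases "card V \<le> k")
    case True
    then show ?thesis by (intro prod.cong) auto
  next
    case False
    \<comment> \<open>With fewer than |V| colours, the factor at i = k vanishes both with truncated
      and with real subtraction, so both products are 0.\<close>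
    then have "\<exists>i\<in>{..<card V}. real (k - i) = 0" "\<exists>i\<in>{..<card V}. real k - real i = 0"
      by (auto intro!: bexI[of _ k])
    then show ?thesis by (simp add: prod_zero)
  qed
  finally show ?thesis .
qed

theorem theorem14:
  fixes G :: "'a ec_graph" and n :: nat and x :: real
  assumes "two_edge_coloured_graph G"
    and "card (verts (under G)) = n"
    and "chromatic_number G = n"
  shows "poly (chromatic_poly (disjoint_union G red_K2)) x =
           (\<Prod>i<n. x - real i) * (x\<^sup>2 - x - 2 * real (card (blues G)))"
proof -
  let ?U = "disjoint_union G red_K2"
  \<comment> \<open>The claimed product as a polynomial, with coefficients listed from the constant
    term upwards.\<close>
  define q :: "real poly"
    where "q = (\<Prod>i<n. [:- real i, 1:]) * [:- 2 * real (card (blues G)), -1, 1:]"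
  have q: "poly q y = (\<Prod>i<n. y - real i) * (y\<^sup>2 - y - 2 * real (card (blues G)))" for y
    by (simp add: q_def poly_prod power2_eq_square algebra_simps)
  have chi: "chromatic_number G = card (verts (under G))"
    using assms by simp
  have fin: "finite (verts (under G))"
    using assms(1) by (simp add: two_edge_coloured_graph_def finite_simple_graph_def)
  \<comment> \<open>Agreement at all natural numbers identifies the two polynomials and so carries
    the counting formula over to every real \<open>x\<close>.\<close>
  have "poly (chromatic_poly ?U) (real k) = poly q (real k)" for k
  proof -
    have "poly (chromatic_poly ?U) (real k) = real_of_int (int (card {d. colouring ?U k d}))"
      using poly_chromatic_poly[OF two_edge_coloured_graph_disjoint_union[OF assms(1)
            two_edge_coloured_graph_red_K2]] by simp
    also have "\<dots> = real (card {c. colouring G k c}) *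
        ((real k)\<^sup>2 - real k - 2 * real (card (blues G)))"
      unfolding card_colourings_disjoint_union_red_K2[OF assms(1) chi] by simp
    also have "\<dots> = poly q (real k)"
      unfolding colourings_eq_inj_on[OF assms(1) chi] real_card_inj_on_eq_prod[OF fin] q assms(2) ..
    finally show ?thesis .
  qed
  then have "chromatic_poly ?U = q"
    by (rule poly_eq_if_eq_on_nat)
  then show ?thesis
    by (simp add: q)
qed

end
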